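(* Let $\lambda$ be the solution of the spatial coagulation equation described in the context, and assume the moment-control condition (A1) stated there, with associated $T_1>0$. Then for $t\in[0,T_1)$ the first moment is conserved at each site, $$m_1(x,t)=\lambda_0(1,x),\qquad x\in\mathcal S,$$ and the local and global second moments satisfy the differential equations $$\frac{d}{dt}m_2(x,t)=m_2(x,t)\sum_{y\in\mathcal S}G(x,y)m_2(y,t),\qquad x\in\mathcal S,$$ $$\frac{d}{dt}M_2(t)=\sum_{x,y\in\mathcal S}G(x,y)m_2(x,t)m_2(y,t).$$
   Context: Setting. $\mathcal S$ is a finite or countably infinite set, and $G:\mathcal S\times\mathcal S\to(0,\infty)$ is a uniformly bounded function (the spatial kernel). $\mathbb N=\{1,2,\dots\}$. One considers densities $\lambda_t(i,x)\ge0$, $i\in\mathbb N$, $x\in\mathcal S$, solving $$\frac{d}{dt}\lambda_t(i,x)=\sum_{y\in\mathcal S}\sum_{j=1}^{i-1}\frac{j}{i}\,j(i-j)\,G(x,y)\lambda_t(j,x)\lambda_t(i-j,y)-i\,\lambda_t(i,x)\sum_{y\in\mathcal S}\sum_{j\ge1}j\,G(x,y)\lambda_t(j,y),$$ with monodisperse normalised initial condition: $\sum_{i\ge1}i\lambda_0(i,x)=\lambda_0(1,x)$ for every $x$ (so $\lambda_0(i,x)=0$ for $i\ge2$) and $\sum_{x\in\mathcal S}\lambda_0(1,x)=1$. Moments: $m_k(x,t)=\sum_{i\ge1}i^k\lambda_t(i,x)$ and $M_k(t)=\sum_{x\in\mathcal S}m_k(x,t)$, $k\in\mathbb N$. Gelation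 time: $t_{\mathrm{gel}}=\sup\{t>0: M_2(t)<\infty\}\in(0,\infty]$. The solution $\lambda$ is the (unique) solution up to the gelation time, i.e. on $[0,t_{\mathrm{gel}})$, with $M_2$ bounded on compact subintervals of $[0,t_{\mathrm{gel}})$, and, if $t_{\mathrm{gel}}<\infty$, $M_2(t)\to\infty$ as $t\uparrow t_{\mathrm{gel}}$; this is a standing fact about the solution. Moment-control condition (A1). There is $T_1>0$ (with $[0,T_1)$ contained in the interval $[0,t_{\mathrm{gel}})$ of existence) such that for every $x\in\mathcal S$ the series $\sum_{y\in\mathcal S}G(x,y)m_2(x,t)m_1(y,t)$ converges uniformly in $t\in[0,T_1)$. *)

theory Defs
  imports "HOL-Analysis.Analysis"
begin

text \<open>
  A family of densities is a function \<open>lam t i x\<close> of time, mass and site; masses range over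
  \<open>{1..}\<close>, so the values at \<open>i = 0\<close> are irrelevant.  Moments are elements of \<open>[0,\<infinity>]\<close>.
\<close>

definition local_moment :: "(real \<Rightarrow> nat \<Rightarrow> 's \<Rightarrow> real) \<Rightarrow> nat \<Rightarrow> 's \<Rightarrow> real \<Rightarrow> ennreal" where
  "local_moment lam k x t = (\<Sum>\<^sub>\<infinity>i\<in>{1..}. ennreal (real i ^ k * lam t i x))"

definition global_moment ::
  "'s set \<Rightarrow> (real \<Rightarrow> nat \<Rightarrow> 's \<Rightarrow> real) \<Rightarrow> nat \<Rightarrow> real \<Rightarrow> ennreal" where
  "global_moment S lam k t = (\<Sum>\<^sub>\<infinity>x\<in>S. local_moment lam k x t)"

definition gelation_time :: "'s set \<Rightarrow> (real \<Rightarrow> nat \<Rightarrow> 's \<Rightarrow> real) \<Rightarrow> ereal" where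
  "gelation_time S lam = Sup (ereal ` {t. 0 < t \<and> global_moment S lam 2 t < \<infinity>})"

definition spatial_kernel :: "'s set \<Rightarrow> ('s \<Rightarrow> 's \<Rightarrow> real) \<Rightarrow> bool" where
  "spatial_kernel S G \<longleftrightarrow>
     (\<forall>x\<in>S. \<forall>y\<in>S. 0 < G x y) \<and> (\<exists>C. \<forall>x\<in>S. \<forall>y\<in>S. G x y \<le> C)"

definition coagulation_rhs ::
  "'s set \<Rightarrow> ('s \<Rightarrow> 's \<Rightarrow> real) \<Rightarrow> (nat \<Rightarrow> 's \<Rightarrow> real) \<Rightarrow> nat \<Rightarrow> 's \<Rightarrow> real" where
  "coagulation_rhs S G mu i x =
     (\<Sum>\<^sub>\<infinity>y\<in>S. \<Sum>j=1..<i. real j / real i * (real j * real (i - j)) * G x y * mu j x * mu (i - j) y)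
     - real i * mu i x * (\<Sum>\<^sub>\<infinity>y\<in>S. \<Sum>\<^sub>\<infinity>j\<in>{1..}. real j * G x y * mu j y)"

text \<open>
  Only the values of the densities before the gelation time are constrained by the equation;
  at time 0 the derivative is one-sided.  A solution living on \<open>[0, t_gel)\<close> only is represented
  by any nonnegative extension whose second moment is infinite from \<open>t_gel\<close> on.  As the second
  moment is finite before \<open>t_gel\<close> and the kernel is bounded, all real-valued infinite sums
  occurring in the equation converge.
\<close>

definition coagulation_solution ::
  "'s set \<Rightarrow> ('s \<Rightarrow> 's \<Rightarrow> real) \<Rightarrow> (real \<Rightarrow> nat \<Rightarrow> 's \<Rightarrow> real) \<Rightarrow> bool" where
  "coagulation_solution S G lam \<longleftrightarrow>
     (\<forall>t\<ge>0. \<forall>i\<ge>1. \<forall>x\<in>S. 0 \<le> lam t i x) \<and>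
     (\<forall>x\<in>S. local_moment lam 1 x 0 = ennreal (lam 0 1 x)) \<and>
     ((\<lambda>x. lam 0 1 x) has_sum 1) S \<and>
     0 < gelation_time S lam \<and>
     (\<forall>t\<ge>0. ereal t < gelation_time S lam \<longrightarrow>
        (\<forall>i\<ge>1. \<forall>x\<in>S.
          ((\<lambda>s. lam s i x) has_real_derivative coagulation_rhs S G (lam t) i x)
            (at t within {0..}))) \<and>
     (\<forall>T\<ge>0. ereal T < gelation_time S lam \<longrightarrow>
        (\<exists>B. \<forall>t\<in>{0..T}. global_moment S lam 2 t \<le> ennreal B)) \<and>
     (gelation_time S lam < \<infinity> \<longrightarrow>
        (global_moment S lam 2 \<longlongrightarrow> \<infinity>) (at_left (real_of_ereal (gelation_time S lam))))"

text \<open>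
  Uniform convergence of the series over \<open>y\<close> is taken along the net of finite partial sums;
  as the terms are nonnegative, this agrees with uniform convergence along any enumeration.
\<close>

definition moment_control ::
  "'s set \<Rightarrow> ('s \<Rightarrow> 's \<Rightarrow> real) \<Rightarrow> (real \<Rightarrow> nat \<Rightarrow> 's \<Rightarrow> real) \<Rightarrow> real \<Rightarrow> bool" where
  "moment_control S G lam T1 \<longleftrightarrow>
     0 < T1 \<and> ereal T1 \<le> gelation_time S lam \<and>
     (\<forall>x\<in>S. uniform_limit {0..<T1}
        (\<lambda>F t. \<Sum>y\<in>F. G x y * enn2real (local_moment lam 2 x t) * enn2real (local_moment lam 1 y t))
        (\<lambda>t. \<Sum>\<^sub>\<infinity>y\<in>S. G x y * enn2real (local_moment lam 2 x t) * enn2real (local_moment lam 1 y t))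
        (finite_subsets_at_top S))"

end

theory Submission
  imports Defs
begin

text \<open>
  Summing the equation at site \<open>x\<close> against weights \<open>i w(i)\<close> of finite support gives the rate
  \<open>\<Sum> G(x,y) j\<^sup>2 \<lambda>(j,x) k \<lambda>(k,y) (w(j+k) - w(j))\<close> over all \<open>y, j, k\<close>.  If \<open>\<bar>w(j+k) - w(j)\<bar> \<le> k\<close>, this is
  dominated by \<open>m\<^sub>2(x) \<Sum>\<^sub>y G(x,y) m\<^sub>2(y)\<close>, which is bounded on compact time intervals before gelation.
  Indicator weights increasing to \<open>1\<close> then give conservation of \<open>m\<^sub>1\<close>, and tent functions
  increasing to \<open>i\<close> give the second-moment equation in integrated form; using gauge integrals,
  no regularity of the time derivatives is needed.  Hence \<open>m\<^sub>2(x,t)\<close> is nondecreasing in \<open>t\<close>, so that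
  on \<open>[0,T]\<close> all series are dominated by their values at \<open>T\<close>, the integrands are continuous, and the
  integral equations can be differentiated.
\<close>

section \<open>Infinite sums\<close>

text \<open>Every finite partial sum of \<open>f\<close> lies below the finite total in
  [0,\<infinity>], which gives summability; \<open>ennreal\<close> is additive on nonnegative finite
  sums and continuous, so it passes through the limit.\<close>

lemma infsum_ennreal_finite:
  fixes f :: "'a \<Rightarrow> real"
  assumes nonneg: "\<And>x. x \<in> A \<Longrightarrow> 0 \<le> f x"
    and fin: "(\<Sum>\<^sub>\<infinity>x\<in>A. ennreal (f x)) < \<infinity>"
  shows "f summable_on A" and "(\<Sum>\<^sub>\<infinity>x\<in>A. ennreal (f x)) = ennreal (infsum f A)"
proof -
  let ?s = "\<Sum>\<^sub>\<infinity>x\<in>A. ennreal (f x)"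
  have le: "sum f F \<le> enn2real ?s" if "finite F" "F \<subseteq> A" for F
  proof -
    have "ennreal (sum f F) = (\<Sum>\<^sub>\<infinity>x\<in>F. ennreal (f x))"
      using that nonneg by (subst sum_ennreal[symmetric]) auto
    also have "\<dots> \<le> ?s"
      using that by (intro infsum_mono_neutral nonneg_summable_on_complete) auto
    finally have "enn2real (ennreal (sum f F)) \<le> enn2real ?s"
      using fin by (intro enn2real_mono) auto
    moreover have "0 \<le> sum f F"
      using that nonneg by (intro sum_nonneg) auto
    ultimately show ?thesis by simp
  qed
  show summable: "f summable_on A"
    by (rule nonneg_bdd_above_summable_on) (use nonneg le in \<open>auto intro!: bdd_aboveI2\<close>)
  have "ennreal (infsum f A) = infsum (ennreal \<circ> f) A"
  proof (rule infsum_comm_additive_general[symmetric])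
    show "sum (ennreal \<circ> f) F = ennreal (sum f F)" if "finite F" "F \<subseteq> A" for F
      using that nonneg by (simp add: o_def) (rule sum_ennreal, auto)
  qed (use summable in auto)
  then show "?s = ennreal (infsum f A)"
    by (simp add: o_def)
qed

lemma has_sum_sum:
  fixes f :: "'i \<Rightarrow> 'a \<Rightarrow> 'b::topological_comm_monoid_add"
  assumes "finite I" "\<And>i. i \<in> I \<Longrightarrow> (f i has_sum s i) A"
  shows "((\<lambda>x. \<Sum>i\<in>I. f i x) has_sum (\<Sum>i\<in>I. s i)) A"
  using assms by (induction I rule: finite_induct) (auto intro!: has_sum_add)

lemma summable_on_sum:
  fixes f :: "'i \<Rightarrow> 'a \<Rightarrow> 'b::topological_comm_monoid_add"
  assumes "finite I" "\<And>i. i \<in> I \<Longrightarrow> f i summable_on A"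
  shows "(\<lambda>x. \<Sum>i\<in>I. f i x) summable_on A"
  using assms by (induction I rule: finite_induct) (auto intro!: summable_on_add)

text \<open>Absolute summability of both factors makes the product summable over
  \<open>A \<times> B\<close>; only then may the double sum be evaluated as an iterated one.\<close>

lemma has_sum_product_real:
  fixes f :: "'a \<Rightarrow> real" and g :: "'b \<Rightarrow> real"
  assumes f: "(f has_sum a) A" and g: "(g has_sum b) B"
  shows "((\<lambda>(i, j). f i * g j) has_sum a * b) (A \<times> B)"
proof -
  have fa: "(\<lambda>i. \<bar>f i\<bar>) summable_on A" and ga: "(\<lambda>j. \<bar>g j\<bar>) summable_on B"
    using f g summable_on_iff_abs_summable_on_real has_sum_imp_summable
    by fastforce+
  have "(\<lambda>(i, j). \<bar>f i\<bar> * \<bar>g j\<bar>) summable_on A \<times> B"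
    by (rule summable_on_SigmaI[where g = "\<lambda>i. \<bar>f i\<bar> * (\<Sum>\<^sub>\<infinity>j\<in>B. \<bar>g j\<bar>)"])
      (use fa ga in \<open>auto intro!: has_sum_cmult_right summable_on_cmult_left\<close>)
  then have "(\<lambda>z. norm (case z of (i, j) \<Rightarrow> f i * g j)) summable_on A \<times> B"
    by (simp add: case_prod_unfold abs_mult)
  then have "(\<lambda>(i, j). f i * g j) summable_on A \<times> B"
    by (rule abs_summable_summable)
  with f g show ?thesis
    by (intro has_sum_SigmaI[where g = "\<lambda>i. f i * b"])
      (auto intro!: has_sum_cmult_right has_sum_cmult_left)
qed

lemma summable_on_real_comparison:
  fixes f g :: "'a \<Rightarrow> real"
  assumes "g summable_on A" "\<And>x. x \<in> A \<Longrightarrow> \<bar>f x\<bar> \<le> g x"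
  shows "f summable_on A"
proof -
  have "(\<lambda>x. norm (f x)) summable_on A"
    by (rule summable_on_comparison_test[OF assms(1)]) (use assms in auto)
  then show ?thesis by (rule abs_summable_summable)
qed

text \<open>Dominated convergence along an arbitrary nontrivial filter: the M-test makes the partial
  sums converge uniformly in \<open>n\<close>, which permits exchanging the two limits.\<close>

lemma infsum_dominated_tendsto:
  fixes f :: "'n \<Rightarrow> 'a \<Rightarrow> real"
  assumes lim: "\<And>x. x \<in> A \<Longrightarrow> ((\<lambda>n. f n x) \<longlongrightarrow> g x) F"
    and bound: "\<And>n x. x \<in> A \<Longrightarrow> \<bar>f n x\<bar> \<le> M x"
    and M: "M summable_on A"
    and F: "F \<noteq> bot"
  shows "((\<lambda>n. \<Sum>\<^sub>\<infinity>x\<in>A. f n x) \<longlongrightarrow> (\<Sum>\<^sub>\<infinity>x\<in>A. g x)) F"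
proof (rule swap_uniform_limit')
  show "\<forall>\<^sub>F X in finite_subsets_at_top A. ((\<lambda>n. \<Sum>x\<in>X. f n x) \<longlongrightarrow> (\<Sum>x\<in>X. g x)) F"
    using lim by (auto intro!: eventually_finite_subsets_at_top_weakI tendsto_sum)
  show "uniform_limit UNIV (\<lambda>X n. \<Sum>x\<in>X. f n x) (\<lambda>n. \<Sum>\<^sub>\<infinity>x\<in>A. f n x) (finite_subsets_at_top A)"
    by (rule Weierstrass_m_test_general[OF _ M]) (use bound in auto)
  have "\<bar>g x\<bar> \<le> M x" if "x \<in> A" for x
    by (rule tendsto_upperbound[OF tendsto_rabs[OF lim[OF that]] _ F]) (simp add: bound that)
  then have "g summable_on A"
    by (rule summable_on_real_comparison[OF M])
  then show "((\<lambda>X. \<Sum>x\<in>X. g x) \<longlongrightarrow> (\<Sum>\<^sub>\<infinity>x\<in>A. g x)) (finite_subsets_at_top A)"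
    by (rule infsum_tendsto)
qed (use F in auto)

section \<open>Weighted rates of the coagulation equation\<close>

text \<open>Real-valued counterpart of \<open>local_moment lam 2\<close>, meaningful only where the
  series converges, since \<open>infsum\<close> defaults to 0 otherwise.\<close>

definition second_moment :: "(nat \<Rightarrow> 's \<Rightarrow> real) \<Rightarrow> 's \<Rightarrow> real" where
  "second_moment mu x = (\<Sum>\<^sub>\<infinity>i\<in>{1..}. real i ^ 2 * mu i x)"

text \<open>With a site \<open>x\<close> fixed, \<open>(y, j, k)\<close> stands for the meeting of a
  cluster of mass \<open>j\<close> at \<open>x\<close> with one of mass \<open>k\<close> at
  \<open>y\<close>.\<close>

abbreviation triples :: "'s set \<Rightarrow> ('s \<times> nat \<times> nat) set" where
  "triples S \<equiv> S \<times> {1..} \<times> {1..}"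

text \<open>State of the system at one instant, with finite total second moment; all estimates that
  do not involve time are made here.\<close>

locale density =
  fixes S :: "'s set" and G :: "'s \<Rightarrow> 's \<Rightarrow> real" and C :: real and mu :: "nat \<Rightarrow> 's \<Rightarrow> real"
  assumes G_nonneg: "\<And>x y. x \<in> S \<Longrightarrow> y \<in> S \<Longrightarrow> 0 \<le> G x y"
    and G_le: "\<And>x y. x \<in> S \<Longrightarrow> y \<in> S \<Longrightarrow> G x y \<le> C"
    and mu_nonneg: "\<And>i x. 1 \<le> i \<Longrightarrow> x \<in> S \<Longrightarrow> 0 \<le> mu i x"
    and local_summable: "\<And>x. x \<in> S \<Longrightarrow> (\<lambda>i. real i ^ 2 * mu i x) summable_on {1..}"
    and global_summable: "(\<lambda>x. \<Sum>\<^sub>\<infinity>i\<in>{1..}. real i ^ 2 * mu i x) summable_on S"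
begin

abbreviation m2 :: "'s \<Rightarrow> real" where
  "m2 \<equiv> second_moment mu"

lemma m2_nonneg: "x \<in> S \<Longrightarrow> 0 \<le> m2 x"
  unfolding second_moment_def by (intro infsum_nonneg) (auto intro!: mult_nonneg_nonneg mu_nonneg)

lemma m2_summable: "m2 summable_on S"
  using global_summable by (simp add: second_moment_def[abs_def])

lemma has_sum_m2: "x \<in> S \<Longrightarrow> ((\<lambda>i. real i ^ 2 * mu i x) has_sum m2 x) {1..}"
  unfolding second_moment_def using local_summable by (intro has_sum_infsum)

lemma interaction_summable:
  assumes "x \<in> S"
  shows "(\<lambda>y. G x y * m2 y) summable_on S"
  by (rule summable_on_real_comparison[where g = "\<lambda>y. C * m2 y"])
    (use assms in \<open>auto intro!: summable_on_cmult_right m2_summable mult_right_mono G_le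
        simp: abs_mult G_nonneg m2_nonneg\<close>)

text \<open>For fixed \<open>y\<close> the double sum factorises into local second moments. The
  series is the common majorant of the weighted rates and also the exact rate for the weight
  \<open>w i = i\<close>, whose increment \<open>w (j + k) - w j = k\<close> supplies the second
  factor \<open>real k\<close>.\<close>

lemma has_sum_pair_rate:
  assumes x: "x \<in> S"
  shows "((\<lambda>(y, j, k). G x y * (real j ^ 2 * mu j x) * (real k ^ 2 * mu k y))
           has_sum m2 x * (\<Sum>\<^sub>\<infinity>y\<in>S. G x y * m2 y)) (triples S)"
proof -
  have inner: "((\<lambda>(j, k). G x y * (real j ^ 2 * mu j x) * (real k ^ 2 * mu k y))
           has_sum m2 x * (G x y * m2 y)) ({1..} \<times> {1..})" if "y \<in> S" for y
    using has_sum_cmult_right[OF has_sum_product_real[OF has_sum_m2[OF x] has_sum_m2[OF that]], of "G x y"]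
    by (simp add: case_prod_unfold mult_ac)
  show ?thesis
  proof (rule has_sum_SigmaI[where g = "\<lambda>y. m2 x * (G x y * m2 y)"])
    show "((\<lambda>y. m2 x * (G x y * m2 y)) has_sum m2 x * (\<Sum>\<^sub>\<infinity>y\<in>S. G x y * m2 y)) S"
      using interaction_summable[OF x] by (intro has_sum_cmult_right has_sum_infsum)
    show "(\<lambda>(y, j, k). G x y * (real j ^ 2 * mu j x) * (real k ^ 2 * mu k y)) summable_on triples S"
      by (rule summable_on_SigmaI[where g = "\<lambda>y. m2 x * (G x y * m2 y)"])
        (use inner interaction_summable[OF x] in
          \<open>auto intro!: summable_on_cmult_right mult_nonneg_nonneg mu_nonneg G_nonneg x\<close>)
  qed (use inner in auto)
qed

lemma first_le_second_moment:
  assumes "1 \<le> k" "y \<in> S"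
  shows "real k * mu k y \<le> real k ^ 2 * mu k y"
  using assms mu_nonneg by (intro mult_right_mono self_le_power) auto

text \<open>Because the bound on \<open>v\<close> involves the partner mass \<open>k\<close> alone,
  it raises \<open>real k\<close> to \<open>real k ^ 2\<close> and leaves \<open>real j ^ 2\<close>
  untouched, so second moments suffice.\<close>

lemma weighted_rate_dominated:
  assumes x: "x \<in> S" and K: "\<And>j k. 1 \<le> j \<Longrightarrow> 1 \<le> k \<Longrightarrow> \<bar>v j k\<bar> \<le> K * real k"
    and yjk: "(y, j, k) \<in> triples S"
  shows "\<bar>G x y * (real j ^ 2 * mu j x) * (real k * mu k y) * v j k\<bar>
    \<le> K * (G x y * (real j ^ 2 * mu j x) * (real k ^ 2 * mu k y))"
proof -
  have nn: "0 \<le> G x y * (real j ^ 2 * mu j x)" "0 \<le> real k * mu k y"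
    using yjk x by (auto intro!: mult_nonneg_nonneg mu_nonneg G_nonneg)
  have "\<bar>G x y * (real j ^ 2 * mu j x) * (real k * mu k y) * v j k\<bar>
      = G x y * (real j ^ 2 * mu j x) * (real k * mu k y) * \<bar>v j k\<bar>"
    using mult_nonneg_nonneg[OF nn] by (subst abs_mult) (simp only: abs_of_nonneg)
  also have "\<dots> \<le> G x y * (real j ^ 2 * mu j x) * (real k * mu k y) * (K * real k)"
    using yjk by (intro mult_left_mono K mult_nonneg_nonneg nn) auto
  finally show ?thesis by (simp add: power2_eq_square mult_ac)
qed

text \<open>The free constant \<open>K\<close> allows gain and loss of a truncated weight to be
  summed separately; the estimates uniform in the truncation take \<open>K = 1\<close>.\<close>

lemma weighted_rate_summable:
  assumes x: "x \<in> S" and K: "\<And>j k. 1 \<le> j \<Longrightarrow> 1 \<le> k \<Longrightarrow> \<bar>v j k\<bar> \<le> K * real k"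
  shows "(\<lambda>(y, j, k). G x y * (real j ^ 2 * mu j x) * (real k * mu k y) * v j k) summable_on triples S"
proof (rule summable_on_real_comparison)
  show "(\<lambda>(y, j, k). K * (G x y * (real j ^ 2 * mu j x) * (real k ^ 2 * mu k y))) summable_on triples S"
    using summable_on_cmult_right[OF has_sum_imp_summable[OF has_sum_pair_rate[OF x]], of K]
    by (simp add: case_prod_unfold)
qed (use weighted_rate_dominated[where v = v and K = K, OF x K] in auto)

lemma abs_weighted_rate_le:
  assumes x: "x \<in> S" and v: "\<And>j k. 1 \<le> j \<Longrightarrow> 1 \<le> k \<Longrightarrow> \<bar>v j k\<bar> \<le> real k"
  shows "\<bar>\<Sum>\<^sub>\<infinity>(y, j, k)\<in>triples S. G x y * (real j ^ 2 * mu j x) * (real k * mu k y) * v j k\<bar>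
    \<le> m2 x * (\<Sum>\<^sub>\<infinity>y\<in>S. G x y * m2 y)"
proof -
  have v1: "\<bar>v j k\<bar> \<le> 1 * real k" if "1 \<le> j" "1 \<le> k" for j k
    using v[OF that] by simp
  have "norm (case z of (y, j, k) \<Rightarrow> G x y * (real j ^ 2 * mu j x) * (real k * mu k y) * v j k)
    \<le> (case z of (y, j, k) \<Rightarrow> G x y * (real j ^ 2 * mu j x) * (real k ^ 2 * mu k y))"
    if "z \<in> triples S" for z
    using weighted_rate_dominated[where v = v and K = 1, OF x v1] that by (cases z) simp
  from norm_infsum_le[OF has_sum_infsum[OF weighted_rate_summable[where v = v and K = 1, OF x v1]]
      has_sum_pair_rate[OF x] this]
  show ?thesis by simp
qed

lemma weighted_rate_tendsto:
  fixes v :: "nat \<Rightarrow> nat \<Rightarrow> nat \<Rightarrow> real"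
  assumes x: "x \<in> S" and v: "\<And>n j k. 1 \<le> j \<Longrightarrow> 1 \<le> k \<Longrightarrow> \<bar>v n j k\<bar> \<le> real k"
    and lim: "\<And>j k. 1 \<le> j \<Longrightarrow> 1 \<le> k \<Longrightarrow> (\<lambda>n. v n j k) \<longlonglongrightarrow> u j k"
  shows "(\<lambda>n. \<Sum>\<^sub>\<infinity>(y, j, k)\<in>triples S. G x y * (real j ^ 2 * mu j x) * (real k * mu k y) * v n j k)
    \<longlonglongrightarrow> (\<Sum>\<^sub>\<infinity>(y, j, k)\<in>triples S. G x y * (real j ^ 2 * mu j x) * (real k * mu k y) * u j k)"
proof (rule infsum_dominated_tendsto[OF _ _ has_sum_imp_summable[OF has_sum_pair_rate[OF x]]])
  fix n z assume z: "z \<in> triples S"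
  have v1: "\<bar>v n j k\<bar> \<le> 1 * real k" if "1 \<le> j" "1 \<le> k" for j k
    using v[OF that] by simp
  show "\<bar>case z of (y, j, k) \<Rightarrow> G x y * (real j ^ 2 * mu j x) * (real k * mu k y) * v n j k\<bar>
    \<le> (case z of (y, j, k) \<Rightarrow> G x y * (real j ^ 2 * mu j x) * (real k ^ 2 * mu k y))"
    using weighted_rate_dominated[where v = "v n" and K = 1, OF x v1] z by (cases z) simp
next
  fix z assume "z \<in> triples S"
  then show "(\<lambda>n. case z of (y, j, k) \<Rightarrow> G x y * (real j ^ 2 * mu j x) * (real k * mu k y) * v n j k)
    \<longlonglongrightarrow> (case z of (y, j, k) \<Rightarrow> G x y * (real j ^ 2 * mu j x) * (real k * mu k y) * u j k)"
    by (cases z) (auto intro!: tendsto_mult_left lim)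
qed auto

text \<open>In the gain term \<open>i = j + k\<close>, and the prefactor \<open>real i\<close>
  cancels the placement probability \<open>real j / real i\<close>, leaving
  \<open>real j ^ 2 * real k\<close>. The loss term carries the same factor, so each meeting
  replaces the weight \<open>w j\<close> by \<open>w (j + k)\<close> at site
  \<open>x\<close>.\<close>

lemma weighted_coagulation_rhs:
  fixes w :: "nat \<Rightarrow> real"
  assumes x: "x \<in> S" and supp: "\<And>i. N < i \<Longrightarrow> w i = 0"
  shows "(\<Sum>i=1..N. w i * (real i * coagulation_rhs S G mu i x))
    = (\<Sum>\<^sub>\<infinity>(y, j, k)\<in>triples S.
        G x y * (real j ^ 2 * mu j x) * (real k * mu k y) * (w (j + k) - w j))"
proof -
  let ?P = "\<lambda>y j k. G x y * (real j ^ 2 * mu j x) * (real k * mu k y)"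
  \<comment> \<open>A crude bound that may grow with the truncation. As \<open>k \<ge> 1\<close>, it
    gives \<open>\<bar>w i\<bar> \<le> K * real k\<close>, so gain and loss converge separately and
    their difference may be split.\<close>
  define K where "K = (\<Sum>i\<le>N. \<bar>w i\<bar>)"
  have wK: "\<bar>w i\<bar> \<le> K" for i
  proof (cases "i \<le> N")
    case True
    then show ?thesis unfolding K_def by (intro member_le_sum) auto
  qed (auto simp: supp K_def sum_nonneg)
  have K0: "0 \<le> K" by (simp add: K_def sum_nonneg)
  have wK': "\<bar>w i\<bar> \<le> K * real k" if "1 \<le> k" for i k
    using wK[of i] mult_left_mono[of 1 "real k" K] that K0 by auto
  have gain_summable: "(\<lambda>(y, j, k). ?P y j k * w (j + k)) summable_on triples S"
    by (rule weighted_rate_summable[OF x wK'])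
  have loss_summable: "(\<lambda>(y, j, k). ?P y j k * w j) summable_on triples S"
    by (rule weighted_rate_summable[OF x wK'])
  have first_summable: "(\<lambda>k. real k * mu k y) summable_on {1..}" if "y \<in> S" for y
    by (rule summable_on_real_comparison[OF local_summable[OF that]])
      (use that first_le_second_moment mu_nonneg in auto)
  have term_le: "real k * mu k y \<le> m2 y" if "1 \<le> k" "y \<in> S" for k y
  proof -
    have "(\<Sum>i\<in>{k}. real i ^ 2 * mu i y) \<le> m2 y"
      unfolding second_moment_def using that mu_nonneg by (intro finite_sum_le_infsum local_summable) auto
    with first_le_second_moment[OF that] show ?thesis by simp
  qed
  \<comment> \<open>Needed to exchange the finite sums over masses with the sum over sites.\<close>
  have site_summable: "(\<lambda>y. ?P y j k) summable_on S" if "1 \<le> j" "1 \<le> k" for j k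
  proof (rule summable_on_real_comparison)
    show "(\<lambda>y. (real j ^ 2 * mu j x) * (G x y * m2 y)) summable_on S"
      by (intro summable_on_cmult_right interaction_summable x)
    fix y assume y: "y \<in> S"
    have "\<bar>?P y j k\<bar> = (real j ^ 2 * mu j x) * (G x y * (real k * mu k y))"
      using that x y by (simp add: abs_mult mu_nonneg G_nonneg)
    also have "\<dots> \<le> (real j ^ 2 * mu j x) * (G x y * m2 y)"
      using that x y by (intro mult_left_mono term_le mult_nonneg_nonneg mu_nonneg G_nonneg) auto
    finally show "\<bar>?P y j k\<bar> \<le> (real j ^ 2 * mu j x) * (G x y * m2 y)" .
  qed

  have gain_inner: "(\<Sum>\<^sub>\<infinity>(j, k)\<in>{1..} \<times> {1..}. ?P y j k * w (j + k))
      = (\<Sum>i=1..N. \<Sum>j=1..<i. ?P y j (i - j) * w i)" for y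
  proof -
    \<comment> \<open>A pair \<open>(j, k)\<close> is encoded by its total mass
      \<open>i = j + k\<close> and by \<open>j\<close>; the strict bound \<open>j < i\<close>
      expresses \<open>k \<ge> 1\<close>, and pairs of total mass above \<open>N\<close> vanish by
      \<open>supp\<close>.\<close>
    let ?D = "SIGMA i:{1..N}. {1..<i}"
    have "(\<Sum>\<^sub>\<infinity>(j, k)\<in>{1..} \<times> {1..}. ?P y j k * w (j + k))
        = (\<Sum>\<^sub>\<infinity>(j, k)\<in>(\<lambda>(i, j). (j, i - j)) ` ?D. ?P y j k * w (j + k))"
    proof (rule infsum_cong_neutral)
      fix z :: "nat \<times> nat" assume z: "z \<in> {1..} \<times> {1..} - (\<lambda>(i, j). (j, i - j)) ` ?D"
      obtain j k where jk: "z = (j, k)" by (cases z)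
      have "z = (\<lambda>(i, j). (j, i - j)) (j + k, j)" using jk by simp
      with z jk have "(j + k, j) \<notin> ?D" by blast
      then have "w (j + k) = 0" using z jk by (intro supp) auto
      then show "(case z of (j, k) \<Rightarrow> ?P y j k * w (j + k)) = 0" by (simp add: jk)
    qed auto
    also have "\<dots> = (\<Sum>(j, k)\<in>(\<lambda>(i, j). (j, i - j)) ` ?D. ?P y j k * w (j + k))"
      by (intro infsum_finite finite_imageI finite_SigmaI) auto
    also have "\<dots> = (\<Sum>(i, j)\<in>?D. ?P y j (i - j) * w i)"
    proof (subst sum.reindex)
      show "inj_on (\<lambda>(i, j). (j, i - j)) ?D"
        by (auto simp: inj_on_def)
      show "sum ((\<lambda>(j, k). ?P y j k * w (j + k)) \<circ> (\<lambda>(i, j). (j, i - j))) ?D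
          = (\<Sum>(i, j)\<in>?D. ?P y j (i - j) * w i)"
        by (rule sum.cong) auto
    qed
    also have "\<dots> = (\<Sum>i=1..N. \<Sum>j=1..<i. ?P y j (i - j) * w i)"
      by (rule sum.Sigma[symmetric]) auto
    finally show ?thesis .
  qed
  have gain: "(\<Sum>\<^sub>\<infinity>(y, j, k)\<in>triples S. ?P y j k * w (j + k))
      = (\<Sum>i=1..N. w i * (real i * (\<Sum>\<^sub>\<infinity>y\<in>S. \<Sum>j=1..<i.
          real j / real i * (real j * real (i - j)) * G x y * mu j x * mu (i - j) y)))"
  proof -
    have "(\<Sum>\<^sub>\<infinity>(y, j, k)\<in>triples S. ?P y j k * w (j + k))
        = (\<Sum>\<^sub>\<infinity>y\<in>S. \<Sum>\<^sub>\<infinity>(j, k)\<in>{1..} \<times> {1..}. ?P y j k * w (j + k))"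
      using infsum_Sigma_banach[OF gain_summable] by simp
    also have "\<dots> = (\<Sum>\<^sub>\<infinity>y\<in>S. \<Sum>i=1..N. \<Sum>j=1..<i. ?P y j (i - j) * w i)"
      by (simp only: gain_inner)
    also have "\<dots> = (\<Sum>i=1..N. \<Sum>\<^sub>\<infinity>y\<in>S. \<Sum>j=1..<i. ?P y j (i - j) * w i)"
    proof (intro infsumI has_sum_sum has_sum_infsum)
      fix i
      show "(\<lambda>y. \<Sum>j=1..<i. ?P y j (i - j) * w i) summable_on S"
        by (intro summable_on_sum summable_on_cmult_left site_summable) auto
    qed auto
    also have "\<dots> = (\<Sum>i=1..N. w i * (real i * (\<Sum>\<^sub>\<infinity>y\<in>S. \<Sum>j=1..<i.
          real j / real i * (real j * real (i - j)) * G x y * mu j x * mu (i - j) y)))"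
    proof (rule sum.cong)
      fix i assume "i \<in> {1..N}"
      \<comment> \<open>Here \<open>i \<ge> 1\<close>, so the division by \<open>real i\<close>
        really cancels.\<close>
      then have "?P y j k * w i
          = (w i * real i) * (real j / real i * (real j * real k) * G x y * mu j x * mu k y)" for y j k
        by (simp add: power2_eq_square)
      then show "(\<Sum>\<^sub>\<infinity>y\<in>S. \<Sum>j=1..<i. ?P y j (i - j) * w i)
          = w i * (real i * (\<Sum>\<^sub>\<infinity>y\<in>S. \<Sum>j=1..<i.
          real j / real i * (real j * real (i - j)) * G x y * mu j x * mu (i - j) y))"
        by (simp only: sum_distrib_left[symmetric] infsum_cmult_right' mult.assoc[of "w i"])
    qed simp
    finally show ?thesis .
  qed
  have loss: "(\<Sum>\<^sub>\<infinity>(y, j, k)\<in>triples S. ?P y j k * w j)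
      = (\<Sum>i=1..N. w i * (real i * (real i * mu i x * (\<Sum>\<^sub>\<infinity>y\<in>S. \<Sum>\<^sub>\<infinity>j\<in>{1..}. real j * G x y * mu j y))))"
  proof -
    \<comment> \<open>The loss weight depends on \<open>j\<close> only, so for each \<open>y\<close>
      the sum over pairs is a product of a finite sum at \<open>x\<close> and a first-moment series
      at \<open>y\<close>.\<close>
    let ?W = "\<Sum>j=1..N. real j ^ 2 * mu j x * w j"
    let ?L = "\<lambda>y. \<Sum>\<^sub>\<infinity>j\<in>{1..}. real j * G x y * mu j y"
    have W: "((\<lambda>j. real j ^ 2 * mu j x * w j) has_sum ?W) {1..}"
      by (rule has_sum_finite_neutralI) (auto simp: supp)
    have inner: "(\<Sum>\<^sub>\<infinity>(j, k)\<in>{1..} \<times> {1..}. ?P y j k * w j) = ?W * ?L y" if "y \<in> S" for y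
    proof -
      have "((\<lambda>k. real k * G x y * mu k y) has_sum ?L y) {1..}"
        using summable_on_cmult_right[OF first_summable[OF that], of "G x y"]
        by (intro has_sum_infsum) (simp add: mult_ac)
      from has_sum_product_real[OF W this] show ?thesis
        by (intro infsumI) (simp add: case_prod_unfold mult_ac)
    qed
    have "(\<Sum>\<^sub>\<infinity>(y, j, k)\<in>triples S. ?P y j k * w j)
        = (\<Sum>\<^sub>\<infinity>y\<in>S. \<Sum>\<^sub>\<infinity>(j, k)\<in>{1..} \<times> {1..}. ?P y j k * w j)"
      using infsum_Sigma_banach[OF loss_summable] by simp
    also have "\<dots> = (\<Sum>\<^sub>\<infinity>y\<in>S. ?W * ?L y)"
      by (rule infsum_cong) (rule inner)
    also have "\<dots> = ?W * (\<Sum>\<^sub>\<infinity>y\<in>S. ?L y)"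
      by (rule infsum_cmult_right')
    also have "\<dots> = (\<Sum>i=1..N. w i * (real i * (real i * mu i x * (\<Sum>\<^sub>\<infinity>y\<in>S. ?L y))))"
      unfolding sum_distrib_right by (rule sum.cong) (simp_all add: power2_eq_square)
    finally show ?thesis .
  qed
  have "(\<Sum>\<^sub>\<infinity>(y, j, k)\<in>triples S. ?P y j k * (w (j + k) - w j))
      = (\<Sum>\<^sub>\<infinity>(y, j, k)\<in>triples S. ?P y j k * w (j + k)) - (\<Sum>\<^sub>\<infinity>(y, j, k)\<in>triples S. ?P y j k * w j)"
    using has_sum_add[OF has_sum_infsum[OF gain_summable] has_sum_uminusI[OF has_sum_infsum[OF loss_summable]]]
    by (intro infsumI) (simp add: case_prod_unfold right_diff_distrib)
  then show ?thesis
    unfolding gain loss coagulation_rhs_def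
    by (simp only: sum_subtractf right_diff_distrib)
qed

end

section \<open>Evolution of the moments\<close>

lemma continuous_infsum:
  fixes f :: "'i \<Rightarrow> real \<Rightarrow> real"
  assumes cont: "\<And>i. i \<in> I \<Longrightarrow> continuous_on A (f i)"
    and bound: "\<And>i t. i \<in> I \<Longrightarrow> t \<in> A \<Longrightarrow> \<bar>f i t\<bar> \<le> M i" and M: "M summable_on I"
  shows "continuous_on A (\<lambda>t. \<Sum>\<^sub>\<infinity>i\<in>I. f i t)"
  by (rule uniform_limit_theorem[OF _ Weierstrass_m_test_general[OF _ M]])
    (use cont bound in \<open>auto intro!: eventually_finite_subsets_at_top_weakI continuous_on_sum\<close>)

text \<open>The hypothesis identifies \<open>F\<close> with \<open>F a\<close> plus an indefinite
  integral of \<open>g\<close>, whose derivative is \<open>g\<close> by continuity; at the endpoints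
  the derivative is one-sided.\<close>

lemma has_real_derivative_if_has_integral:
  fixes F g :: "real \<Rightarrow> real"
  assumes cont: "continuous_on {a..b} g"
    and int: "\<And>t. t \<in> {a..b} \<Longrightarrow> (g has_integral F t - F a) {a..t}"
    and t: "t \<in> {a..b}"
  shows "(F has_real_derivative g t) (at t within {a..b})"
proof -
  have "((\<lambda>u. F a + integral {a..u} g) has_real_derivative g t) (at t within {a..b})"
    by (rule derivative_eq_intros integral_has_real_derivative[OF cont t] refl)+ simp
  then show ?thesis
  proof (rule has_field_derivative_transform_within[OF _ zero_less_one t])
    show "F a + integral {a..u} g = F u" if "u \<in> {a..b}" for u
      using integral_unique[OF int[OF that]] by simp
  qed
qed

text \<open>The solution on a closed time interval, with one bound \<open>B\<close> for the total
  second moment throughout.\<close>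

locale coagulation_flow =
  fixes S :: "'s set" and G :: "'s \<Rightarrow> 's \<Rightarrow> real" and C :: real
    and lam :: "real \<Rightarrow> nat \<Rightarrow> 's \<Rightarrow> real" and T B :: real
  assumes T_nonneg: "0 \<le> T"
    and density: "\<And>t. t \<in> {0..T} \<Longrightarrow> density S G C (lam t)"
    and deriv: "\<And>t i x. t \<in> {0..T} \<Longrightarrow> 1 \<le> i \<Longrightarrow> x \<in> S \<Longrightarrow>
      ((\<lambda>s. lam s i x) has_real_derivative coagulation_rhs S G (lam t) i x) (at t within {0..T})"
    and total_le: "\<And>t. t \<in> {0..T} \<Longrightarrow> (\<Sum>\<^sub>\<infinity>x\<in>S. second_moment (lam t) x) \<le> B"
begin

abbreviation m2 :: "'s \<Rightarrow> real \<Rightarrow> real" where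
  "m2 x t \<equiv> second_moment (lam t) x"

text \<open>The claimed time derivative of \<open>m2 x\<close>.\<close>

definition growth :: "'s \<Rightarrow> real \<Rightarrow> real" where
  "growth x t = m2 x t * (\<Sum>\<^sub>\<infinity>y\<in>S. G x y * m2 y t)"

section \<open>Bounds uniform in time\<close>

lemma m2_nonneg: "t \<in> {0..T} \<Longrightarrow> x \<in> S \<Longrightarrow> 0 \<le> m2 x t"
  by (rule density.m2_nonneg[OF density])

lemma m2_summable: "t \<in> {0..T} \<Longrightarrow> (\<lambda>x. m2 x t) summable_on S"
  by (rule density.m2_summable[OF density])

lemma m2_le: "t \<in> {0..T} \<Longrightarrow> x \<in> S \<Longrightarrow> m2 x t \<le> B"
  using finite_sum_le_infsum[OF m2_summable, of t "{x}"] total_le[of t] m2_nonneg by fastforce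

lemma B_nonneg: "0 \<le> B"
  using infsum_nonneg[of S "\<lambda>x. m2 x 0"] m2_nonneg[of 0] total_le[of 0] T_nonneg by fastforce

lemma G_nonneg: "x \<in> S \<Longrightarrow> y \<in> S \<Longrightarrow> 0 \<le> G x y"
  using density.G_nonneg[OF density[of 0]] T_nonneg by simp

lemma G_le: "x \<in> S \<Longrightarrow> y \<in> S \<Longrightarrow> G x y \<le> C"
  using density.G_le[OF density[of 0]] T_nonneg by simp

text \<open>The site \<open>x\<close> serves to exclude an empty \<open>S\<close>, for which an
  upper bound \<open>C\<close> could be negative.\<close>

lemma C_nonneg: "x \<in> S \<Longrightarrow> 0 \<le> C"
  using G_nonneg[of x x] G_le[of x x] by simp

lemma interaction_summable: "t \<in> {0..T} \<Longrightarrow> x \<in> S \<Longrightarrow> (\<lambda>y. G x y * m2 y t) summable_on S"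
  by (rule density.interaction_summable[OF density])

lemma interaction_nonneg: "t \<in> {0..T} \<Longrightarrow> x \<in> S \<Longrightarrow> 0 \<le> (\<Sum>\<^sub>\<infinity>y\<in>S. G x y * m2 y t)"
  by (intro infsum_nonneg mult_nonneg_nonneg G_nonneg m2_nonneg)

lemma interaction_le:
  assumes "t \<in> {0..T}" "x \<in> S"
  shows "(\<Sum>\<^sub>\<infinity>y\<in>S. G x y * m2 y t) \<le> C * B"
proof -
  have "(\<Sum>\<^sub>\<infinity>y\<in>S. G x y * m2 y t) \<le> (\<Sum>\<^sub>\<infinity>y\<in>S. C * m2 y t)"
    using assms by (intro infsum_mono interaction_summable summable_on_cmult_right m2_summable
        mult_right_mono G_le m2_nonneg)
  also have "\<dots> \<le> C * B"
    unfolding infsum_cmult_right' using assms by (intro mult_left_mono total_le C_nonneg)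
  finally show ?thesis .
qed

lemma growth_nonneg: "t \<in> {0..T} \<Longrightarrow> x \<in> S \<Longrightarrow> 0 \<le> growth x t"
  unfolding growth_def by (intro mult_nonneg_nonneg m2_nonneg interaction_nonneg)

lemma growth_le: "t \<in> {0..T} \<Longrightarrow> x \<in> S \<Longrightarrow> growth x t \<le> m2 x t * (C * B)"
  unfolding growth_def by (intro mult_left_mono interaction_le m2_nonneg)

text \<open>
  Truncating the limit weight \<open>w i = i\<close> sharply would violate the Lipschitz bound and require
  third moments.
\<close>

lemma weak_form:
  fixes W :: "nat \<Rightarrow> nat \<Rightarrow> real" and w :: "nat \<Rightarrow> real"
  assumes x: "x \<in> S" and ab: "0 \<le> a" "a \<le> b" "b \<le> T"
    and supp: "\<And>n i. N n < i \<Longrightarrow> W n i = 0"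
    and lipschitz: "\<And>n j k. 1 \<le> j \<Longrightarrow> 1 \<le> k \<Longrightarrow> \<bar>W n (j + k) - W n j\<bar> \<le> real k"
    and bound: "\<And>n i. 1 \<le> i \<Longrightarrow> \<bar>W n i\<bar> \<le> real i"
    and lim: "\<And>i. (\<lambda>n. W n i) \<longlonglongrightarrow> w i"
  shows "((\<lambda>s. \<Sum>\<^sub>\<infinity>(y, j, k)\<in>triples S.
           G x y * (real j ^ 2 * lam s j x) * (real k * lam s k y) * (w (j + k) - w j))
         has_integral (\<Sum>\<^sub>\<infinity>i\<in>{1..}. w i * (real i * lam b i x))
           - (\<Sum>\<^sub>\<infinity>i\<in>{1..}. w i * (real i * lam a i x))) {a..b}"
proof (rule has_integral_dominated_convergence)
  let ?r = "\<lambda>n s. \<Sum>i=1..N n. W n i * (real i * coagulation_rhs S G (lam s) i x)"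
  let ?Q = "\<lambda>n s. \<Sum>i=1..N n. W n i * (real i * lam s i x)"
  have r_eq: "?r n s = (\<Sum>\<^sub>\<infinity>(y, j, k)\<in>triples S.
      G x y * (real j ^ 2 * lam s j x) * (real k * lam s k y) * (W n (j + k) - W n j))"
    if "s \<in> {a..b}" for n s
    using that ab by (intro density.weighted_coagulation_rhs[OF density x supp]) auto
  \<comment> \<open>\<open>?r n\<close> is the time derivative of the truncated moment
    \<open>?Q n\<close>, a finite sum, so differentiation is termwise.\<close>
  show "(?r n has_integral ?Q n b - ?Q n a) {a..b}" for n
  proof (rule fundamental_theorem_of_calculus)
    fix s assume s: "s \<in> {a..b}"
    have "((\<lambda>s. lam s i x) has_real_derivative coagulation_rhs S G (lam s) i x) (at s within {a..b})"
      if "1 \<le> i" for i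
      by (rule has_field_derivative_subset[OF deriv]) (use s ab that x in auto)
    then have "(?Q n has_real_derivative ?r n s) (at s within {a..b})"
      by (intro DERIV_sum DERIV_cmult) auto
    then show "(?Q n has_vector_derivative ?r n s) (at s within {a..b})"
      by (simp add: has_real_derivative_iff_has_vector_derivative)
  qed (use ab in auto)
  \<comment> \<open>The constant majorant bounds \<open>growth x s\<close>: one factor
    \<open>B\<close> for \<open>m2 x s\<close> and \<open>C * B\<close> for the interaction sum. It
    depends neither on \<open>n\<close> nor on \<open>s\<close>.\<close>
  show "(\<lambda>s. B * (C * B)) integrable_on {a..b}"
    by (rule integrable_const_ivl)
  show "\<forall>s\<in>{a..b}. norm (?r n s) \<le> B * (C * B)" for n
  proof
    fix s assume s: "s \<in> {a..b}"
    then have sT: "s \<in> {0..T}" using ab by auto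
    have "\<bar>?r n s\<bar> \<le> growth x s"
      unfolding r_eq[OF s] growth_def
      by (rule density.abs_weighted_rate_le[OF density[OF sT] x lipschitz])
    also have "\<dots> \<le> m2 x s * (C * B)"
      by (rule growth_le[OF sT x])
    also have "\<dots> \<le> B * (C * B)"
      by (intro mult_right_mono m2_le sT x mult_nonneg_nonneg C_nonneg[OF x] B_nonneg)
    finally show "norm (?r n s) \<le> B * (C * B)" by simp
  qed
  show "\<forall>s\<in>{a..b}. (\<lambda>n. ?r n s) \<longlonglongrightarrow> (\<Sum>\<^sub>\<infinity>(y, j, k)\<in>triples S.
      G x y * (real j ^ 2 * lam s j x) * (real k * lam s k y) * (w (j + k) - w j))"
  proof
    fix s assume s: "s \<in> {a..b}"
    then have sT: "s \<in> {0..T}" using ab by auto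
    show "(\<lambda>n. ?r n s) \<longlonglongrightarrow> (\<Sum>\<^sub>\<infinity>(y, j, k)\<in>triples S.
      G x y * (real j ^ 2 * lam s j x) * (real k * lam s k y) * (w (j + k) - w j))"
      unfolding r_eq[OF s]
      by (rule density.weighted_rate_tendsto[OF density[OF sT] x lipschitz])
        (auto intro!: tendsto_diff lim)
  qed
  \<comment> \<open>Since \<open>\<bar>W n i\<bar> \<le> real i\<close>, the terms are dominated by
    those of the second moment, and the truncation can be removed at each fixed time.\<close>
  have "(\<lambda>n. ?Q n t) \<longlonglongrightarrow> (\<Sum>\<^sub>\<infinity>i\<in>{1..}. w i * (real i * lam t i x))" if t: "t \<in> {0..T}" for t
  proof -
    have "?Q n t = (\<Sum>\<^sub>\<infinity>i\<in>{1..}. W n i * (real i * lam t i x))" for n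
      by (rule infsumI[symmetric], rule has_sum_finite_neutralI) (auto simp: supp)
    moreover have "(\<lambda>n. \<Sum>\<^sub>\<infinity>i\<in>{1..}. W n i * (real i * lam t i x))
        \<longlonglongrightarrow> (\<Sum>\<^sub>\<infinity>i\<in>{1..}. w i * (real i * lam t i x))"
    proof (rule infsum_dominated_tendsto[OF _ _ density.local_summable[OF density[OF t] x]])
      fix n and i :: nat assume i: "i \<in> {1..}"
      then have nn: "0 \<le> lam t i x"
        using density.mu_nonneg[OF density[OF t]] x by simp
      have "\<bar>W n i * (real i * lam t i x)\<bar> = \<bar>W n i\<bar> * (real i * lam t i x)"
        using nn by (simp add: abs_mult)
      also have "\<dots> \<le> real i * (real i * lam t i x)"
        using i nn by (intro mult_right_mono bound) auto
      finally show "\<bar>W n i * (real i * lam t i x)\<bar> \<le> real i ^ 2 * lam t i x"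
        by (simp add: power2_eq_square)
    qed (auto intro!: tendsto_mult_right lim)
    ultimately show ?thesis by simp
  qed
  then show "(\<lambda>n. ?Q n b - ?Q n a) \<longlonglongrightarrow> (\<Sum>\<^sub>\<infinity>i\<in>{1..}. w i * (real i * lam b i x))
      - (\<Sum>\<^sub>\<infinity>i\<in>{1..}. w i * (real i * lam a i x))"
    using ab by (intro tendsto_diff) auto
qed

section \<open>Integrated moment equations\<close>

lemma first_moment_conserved:
  assumes x: "x \<in> S" and t: "t \<in> {0..T}"
  shows "(\<Sum>\<^sub>\<infinity>i\<in>{1..}. real i * lam t i x) = (\<Sum>\<^sub>\<infinity>i\<in>{1..}. real i * lam 0 i x)"
proof -
  \<comment> \<open>A sharp cut-off is admissible here: an indicator jumps by at most 1, hence by at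
    most \<open>real k\<close>. Its limit is constant, so the limiting rate carries the factor
    \<open>1 - 1\<close>.\<close>
  have "(\<lambda>n. if i \<le> n then 1 else 0 :: real) \<longlonglongrightarrow> 1" for i :: nat
    by (rule tendsto_eventually) (auto intro: eventually_sequentiallyI[of i])
  then have "((\<lambda>s. \<Sum>\<^sub>\<infinity>(y, j, k)\<in>triples S.
           G x y * (real j ^ 2 * lam s j x) * (real k * lam s k y) * (1 - 1))
      has_integral (\<Sum>\<^sub>\<infinity>i\<in>{1..}. 1 * (real i * lam t i x)) - (\<Sum>\<^sub>\<infinity>i\<in>{1..}. 1 * (real i * lam 0 i x))) {0..t}"
    using t by (intro weak_form[OF x, where N = "\<lambda>n. n" and W = "\<lambda>n i. if i \<le> n then 1 else 0"]) auto
  then have "((\<lambda>s. 0) has_integral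
      (\<Sum>\<^sub>\<infinity>i\<in>{1..}. real i * lam t i x) - (\<Sum>\<^sub>\<infinity>i\<in>{1..}. real i * lam 0 i x)) {0..t}"
    by (simp add: case_prod_unfold)
  from has_integral_unique[OF this has_integral_0] show ?thesis by simp
qed

lemma growth_has_integral:
  assumes x: "x \<in> S" and ab: "0 \<le> a" "a \<le> b" "b \<le> T"
  shows "(growth x has_integral m2 x b - m2 x a) {a..b}"
proof -
  \<comment> \<open>Slope 1 up to height \<open>n\<close> at \<open>i = n\<close>, then slope -1
    down to 0 at \<open>i = 2 * n\<close>: this gives the Lipschitz bound and the support bound
    \<open>N n = 2 * n\<close>. For fixed \<open>i\<close> the value is \<open>real i\<close> as
    soon as \<open>n \<ge> i\<close>.\<close>
  let ?tent = "\<lambda>(n::nat) (i::nat). max 0 (min (real i) (2 * real n - real i))"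
  have "(\<lambda>n. ?tent n i) \<longlonglongrightarrow> real i" for i
    by (rule tendsto_eventually) (auto intro: eventually_sequentiallyI[of i])
  then have "((\<lambda>s. \<Sum>\<^sub>\<infinity>(y, j, k)\<in>triples S.
           G x y * (real j ^ 2 * lam s j x) * (real k * lam s k y) * (real (j + k) - real j))
      has_integral (\<Sum>\<^sub>\<infinity>i\<in>{1..}. real i * (real i * lam b i x))
        - (\<Sum>\<^sub>\<infinity>i\<in>{1..}. real i * (real i * lam a i x))) {a..b}"
    by (intro weak_form[OF x ab, where N = "\<lambda>n. 2 * n" and W = ?tent]) auto
  then have "((\<lambda>s. \<Sum>\<^sub>\<infinity>(y, j, k)\<in>triples S.
           G x y * (real j ^ 2 * lam s j x) * (real k * lam s k y) * (real (j + k) - real j))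
         has_integral m2 x b - m2 x a) {a..b}"
    by (simp only: second_moment_def power2_eq_square mult.assoc)
  \<comment> \<open>The limiting increment is \<open>real k\<close>, so the rate is exactly the pair
    rate.\<close>
  moreover have "(\<Sum>\<^sub>\<infinity>(y, j, k)\<in>triples S.
      G x y * (real j ^ 2 * lam s j x) * (real k * lam s k y) * (real (j + k) - real j)) = growth x s"
    if "s \<in> {a..b}" for s
    using density.has_sum_pair_rate[OF density x, of s] that ab unfolding growth_def
    by (intro infsumI) (simp add: power2_eq_square mult_ac)
  ultimately show ?thesis
    by (rule has_integral_eq[rotated])
qed

text \<open>The increment is the integral of a nonnegative rate. This makes the values at time
  \<open>T\<close> majorants for all earlier times.\<close>

lemma m2_mono:
  assumes "x \<in> S" "0 \<le> s" "s \<le> t" "t \<le> T"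
  shows "m2 x s \<le> m2 x t"
  using has_integral_nonneg[OF growth_has_integral[OF assms]] growth_nonneg assms by auto

lemma m2_continuous: "x \<in> S \<Longrightarrow> continuous_on {0..T} (m2 x)"
proof -
  assume x: "x \<in> S"
  have "continuous_on {0..T} (\<lambda>t. m2 x 0 + integral {0..t} (growth x))"
    using growth_has_integral[OF x, of 0 T] T_nonneg
    by (intro continuous_intros indefinite_integral_continuous_1) auto
  moreover have "m2 x t = m2 x 0 + integral {0..t} (growth x)" if "t \<in> {0..T}" for t
    using integral_unique[OF growth_has_integral[OF x, of 0 t]] that by simp
  ultimately show ?thesis
    by (rule continuous_on_eq[OF _ sym])
qed

text \<open>By monotonicity \<open>G x y * m2 y T\<close> is a summable majorant free of
  \<open>t\<close>, so the interaction sum is a uniform limit of continuous functions.\<close>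

lemma growth_continuous:
  assumes x: "x \<in> S"
  shows "continuous_on {0..T} (growth x)"
  unfolding growth_def[abs_def]
proof (intro continuous_on_mult m2_continuous[OF x] continuous_infsum)
  show "\<bar>G x y * m2 y t\<bar> \<le> G x y * m2 y T" if "y \<in> S" "t \<in> {0..T}" for y t
    using that x T_nonneg by (auto simp: abs_mult G_nonneg m2_nonneg intro!: mult_left_mono m2_mono)
qed (use x T_nonneg in \<open>auto intro!: interaction_summable continuous_on_mult_left m2_continuous\<close>)

text \<open>The bound is free of \<open>t\<close> and summable over \<open>x\<close>, as the M-test
  for the sum over sites requires.\<close>

lemma growth_dominated:
  assumes "x \<in> S" "t \<in> {0..T}"
  shows "\<bar>growth x t\<bar> \<le> m2 x T * (C * B)"
proof -
  have "growth x t \<le> m2 x t * (C * B)" by (rule growth_le) (use assms in auto)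
  also have "\<dots> \<le> m2 x T * (C * B)"
    using assms by (intro mult_right_mono m2_mono mult_nonneg_nonneg C_nonneg B_nonneg) auto
  finally show ?thesis using growth_nonneg assms by simp
qed

lemma dominating_growth_summable: "(\<lambda>x. m2 x T * (C * B)) summable_on S"
  using T_nonneg by (intro summable_on_cmult_left m2_summable) auto

lemma m2_has_derivative:
  assumes x: "x \<in> S" and t: "t \<in> {0..T}"
  shows "(m2 x has_real_derivative growth x t) (at t within {0..T})"
  by (rule has_real_derivative_if_has_integral[OF growth_continuous[OF x] growth_has_integral[OF x] t]) auto

section \<open>The global second moment\<close>

lemma total_growth_has_integral:
  assumes t: "t \<in> {0..T}"
  shows "((\<lambda>s. \<Sum>\<^sub>\<infinity>x\<in>S. growth x s) has_integral (\<Sum>\<^sub>\<infinity>x\<in>S. m2 x t) - (\<Sum>\<^sub>\<infinity>x\<in>S. m2 x 0)) {0..t}"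
proof -
  \<comment> \<open>Extension by 0 off \<open>S\<close> makes the partial sums continuous for every
    index set \<open>F\<close>, not only for those inside \<open>S\<close>.\<close>
  define g where "g x s = (if x \<in> S then growth x s else 0)" for x s
  have "uniform_limit {0..t} (\<lambda>F s. \<Sum>x\<in>F. g x s) (\<lambda>s. \<Sum>\<^sub>\<infinity>x\<in>S. g x s) (finite_subsets_at_top S)"
    by (rule Weierstrass_m_test_general[OF _ dominating_growth_summable])
      (use growth_dominated t in \<open>auto simp: g_def\<close>)
  moreover have "continuous_on {0..t} (\<lambda>s. \<Sum>x\<in>F. g x s)" for F
  proof (intro continuous_on_sum)
    fix x
    show "continuous_on {0..t} (g x)"
      using t by (cases "x \<in> S") (auto simp: g_def intro: continuous_on_subset[OF growth_continuous])
  qed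
  ultimately obtain I J where I: "\<And>F. ((\<lambda>s. \<Sum>x\<in>F. g x s) has_integral I F) {0..t}"
    and J: "((\<lambda>s. \<Sum>\<^sub>\<infinity>x\<in>S. g x s) has_integral J) {0..t}"
    and lim: "(I \<longlongrightarrow> J) (finite_subsets_at_top S)"
    by (rule uniform_limit_integral) auto
  \<comment> \<open>For finite subsets of \<open>S\<close> the local equations determine the
    integral; \<open>J\<close> is then recovered as the limit of \<open>I\<close> along the net of
    finite subsets.\<close>
  have "I F = (\<Sum>x\<in>F. m2 x t) - (\<Sum>x\<in>F. m2 x 0)" if F: "finite F" "F \<subseteq> S" for F
  proof -
    have "((\<lambda>s. \<Sum>x\<in>F. growth x s) has_integral (\<Sum>x\<in>F. m2 x t - m2 x 0)) {0..t}"
      using F t by (intro has_integral_sum growth_has_integral) auto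
    moreover have "(\<Sum>x\<in>F. g x s) = (\<Sum>x\<in>F. growth x s)" for s
      using F by (intro sum.cong) (auto simp: g_def)
    ultimately show ?thesis
      using has_integral_unique[OF I[of F]] by (simp add: sum_subtractf)
  qed
  then have ev: "\<forall>\<^sub>F F in finite_subsets_at_top S. (\<Sum>x\<in>F. m2 x t) - (\<Sum>x\<in>F. m2 x 0) = I F"
    by (auto intro: eventually_finite_subsets_at_top_weakI)
  have "((\<lambda>F. (\<Sum>x\<in>F. m2 x t) - (\<Sum>x\<in>F. m2 x 0))
      \<longlongrightarrow> (\<Sum>\<^sub>\<infinity>x\<in>S. m2 x t) - (\<Sum>\<^sub>\<infinity>x\<in>S. m2 x 0)) (finite_subsets_at_top S)"
    using t T_nonneg by (intro tendsto_diff infsum_tendsto m2_summable) auto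
  from tendsto_unique[OF finite_subsets_at_top_neq_bot lim Lim_transform_eventually[OF this ev]]
  have "J = (\<Sum>\<^sub>\<infinity>x\<in>S. m2 x t) - (\<Sum>\<^sub>\<infinity>x\<in>S. m2 x 0)" .
  moreover have "(\<Sum>\<^sub>\<infinity>x\<in>S. g x s) = (\<Sum>\<^sub>\<infinity>x\<in>S. growth x s)" for s
    by (rule infsum_cong) (simp add: g_def)
  ultimately show ?thesis using J by simp
qed

text \<open>Passing from the iterated sum to one over \<open>S \<times> S\<close> needs joint
  summability, which follows from the majorant \<open>C * (m2 x t * m2 y t)\<close>.\<close>

lemma infsum_growth:
  assumes t: "t \<in> {0..T}"
  shows "(\<Sum>\<^sub>\<infinity>x\<in>S. growth x t) = (\<Sum>\<^sub>\<infinity>(x, y)\<in>S \<times> S. G x y * m2 x t * m2 y t)"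
proof -
  note sum_m2 = has_sum_infsum[OF m2_summable[OF t]]
  have "(\<lambda>(x, y). G x y * m2 x t * m2 y t) summable_on S \<times> S"
  proof (rule summable_on_real_comparison)
    show "(\<lambda>z. C * (case z of (x, y) \<Rightarrow> m2 x t * m2 y t)) summable_on S \<times> S"
      by (intro summable_on_cmult_right has_sum_imp_summable[OF has_sum_product_real[OF sum_m2 sum_m2]])
    fix z assume "z \<in> S \<times> S"
    then show "\<bar>case z of (x, y) \<Rightarrow> G x y * m2 x t * m2 y t\<bar> \<le> C * (case z of (x, y) \<Rightarrow> m2 x t * m2 y t)"
      using t by (auto simp: abs_mult G_nonneg m2_nonneg mult.assoc intro!: mult_right_mono G_le)
  qed
  from infsum_Sigma_banach[OF this]
  have "(\<Sum>\<^sub>\<infinity>(x, y)\<in>S \<times> S. G x y * m2 x t * m2 y t) = (\<Sum>\<^sub>\<infinity>x\<in>S. \<Sum>\<^sub>\<infinity>y\<in>S. m2 x t * (G x y * m2 y t))"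
    by (simp add: mult_ac)
  then show ?thesis
    by (simp only: growth_def infsum_cmult_right')
qed

lemma total_m2_has_derivative:
  assumes t: "t \<in> {0..T}"
  shows "((\<lambda>s. \<Sum>\<^sub>\<infinity>x\<in>S. m2 x s) has_real_derivative
      (\<Sum>\<^sub>\<infinity>(x, y)\<in>S \<times> S. G x y * m2 x t * m2 y t)) (at t within {0..T})"
  unfolding infsum_growth[OF t, symmetric]
  by (rule has_real_derivative_if_has_integral[OF _ total_growth_has_integral t])
    (auto intro!: continuous_infsum[OF growth_continuous growth_dominated dominating_growth_summable])

end

section \<open>Extended real moments\<close>

lemma infsum_ennreal_le:
  fixes f :: "'a \<Rightarrow> ennreal"
  assumes "A \<subseteq> B" "\<And>x. x \<in> A \<Longrightarrow> f x \<le> g x"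
  shows "infsum f A \<le> infsum g B"
  by (rule infsum_mono_neutral) (use assms in \<open>auto intro!: nonneg_summable_on_complete\<close>)

lemma local_moment_2:
  assumes "\<And>i. 1 \<le> i \<Longrightarrow> 0 \<le> lam t i x" "local_moment lam 2 x t < \<infinity>"
  shows "(\<lambda>i. real i ^ 2 * lam t i x) summable_on {1..}"
    and "local_moment lam 2 x t = ennreal (second_moment (lam t) x)"
  using infsum_ennreal_finite[of "{1..}" "\<lambda>i. real i ^ 2 * lam t i x"] assms
  by (auto simp: local_moment_def second_moment_def)

text \<open>Masses are at least 1, so the first moment is dominated by the second and is finite with
  it.\<close>

lemma local_moment_1:
  assumes nonneg: "\<And>i. 1 \<le> i \<Longrightarrow> 0 \<le> lam t i x" and fin: "local_moment lam 2 x t < \<infinity>"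
  shows "local_moment lam 1 x t = ennreal (\<Sum>\<^sub>\<infinity>i\<in>{1..}. real i * lam t i x)"
proof -
  have "local_moment lam 1 x t \<le> local_moment lam 2 x t"
    unfolding local_moment_def
    by (intro infsum_ennreal_le ennreal_leI mult_right_mono power_increasing) (auto simp: nonneg)
  then have "local_moment lam 1 x t < \<infinity>"
    using fin by (rule le_less_trans)
  then show ?thesis
    using infsum_ennreal_finite(2)[of "{1..}" "\<lambda>i. real i * lam t i x"] nonneg
    by (simp add: local_moment_def)
qed

lemma local_moment_le_global: "x \<in> S \<Longrightarrow> local_moment lam k x t \<le> global_moment S lam k t"
  using infsum_ennreal_le[of "{x}" S "\<lambda>x. local_moment lam k x t"]
  by (simp add: global_moment_def)

lemma global_moment_2:
  assumes nonneg: "\<And>i x. 1 \<le> i \<Longrightarrow> x \<in> S \<Longrightarrow> 0 \<le> lam t i x" and fin: "global_moment S lam 2 t < \<infinity>"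
  shows "second_moment (lam t) summable_on S"
    and "global_moment S lam 2 t = ennreal (\<Sum>\<^sub>\<infinity>x\<in>S. second_moment (lam t) x)"
proof -
  have loc: "local_moment lam 2 x t = ennreal (second_moment (lam t) x)" if "x \<in> S" for x
    by (rule local_moment_2(2)[OF nonneg le_less_trans[OF local_moment_le_global[OF that] fin]])
      (use that in auto)
  then have eq: "global_moment S lam 2 t = (\<Sum>\<^sub>\<infinity>x\<in>S. ennreal (second_moment (lam t) x))"
    unfolding global_moment_def by (rule infsum_cong)
  have nn: "0 \<le> second_moment (lam t) x" if "x \<in> S" for x
    unfolding second_moment_def using nonneg that by (intro infsum_nonneg) auto
  show "second_moment (lam t) summable_on S"
    by (rule infsum_ennreal_finite(1)) (use nn eq fin in auto)
  show "global_moment S lam 2 t = ennreal (\<Sum>\<^sub>\<infinity>x\<in>S. second_moment (lam t) x)"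
    unfolding eq by (rule infsum_ennreal_finite(2)) (use nn eq fin in auto)
qed

text \<open>Reduces the extended-valued setting to the real-valued one on any interval ending
  strictly before gelation. Finiteness of the second moment is exported as well, because
  \<open>enn2real\<close> sends \<infinity> to 0.\<close>

lemma coagulation_solution_flow:
  assumes G: "spatial_kernel S G" and sol: "coagulation_solution S G lam"
    and T: "0 \<le> T" "ereal T < gelation_time S lam"
  obtains C B where "coagulation_flow S G C lam T B"
    and "\<And>t. t \<in> {0..T} \<Longrightarrow> global_moment S lam 2 t < \<infinity>"
proof -
  obtain C where C: "\<And>x y. x \<in> S \<Longrightarrow> y \<in> S \<Longrightarrow> G x y \<le> C"
    using G unfolding spatial_kernel_def by blast
  obtain B where B: "\<And>t. t \<in> {0..T} \<Longrightarrow> global_moment S lam 2 t \<le> ennreal B"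
    using sol T unfolding coagulation_solution_def by blast
  have nonneg: "0 \<le> lam t i x" if "0 \<le> t" "1 \<le> i" "x \<in> S" for t i x
    using sol that unfolding coagulation_solution_def by blast
  have fin: "global_moment S lam 2 t < \<infinity>" if "t \<in> {0..T}" for t
    using le_less_trans[OF B[OF that] ennreal_less_top] by simp
  \<comment> \<open>\<open>ennreal\<close> maps negative reals to 0, so a negative \<open>B\<close>
    must be replaced by 0 to bound the real-valued sum.\<close>
  have "coagulation_flow S G C lam T (max 0 B)"
  proof (rule coagulation_flow.intro)
    fix t i x assume t: "t \<in> {0..T}" and i: "1 \<le> (i::nat)" and x: "x \<in> S"
    have "ereal t < gelation_time S lam"
      using t by (intro le_less_trans[OF _ T(2)]) simp
    then have "((\<lambda>s. lam s i x) has_real_derivative coagulation_rhs S G (lam t) i x) (at t within {0..})"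
      using sol t i x unfolding coagulation_solution_def by auto
    then show "((\<lambda>s. lam s i x) has_real_derivative coagulation_rhs S G (lam t) i x) (at t within {0..T})"
      by (rule has_field_derivative_subset) auto
  next
    fix t assume t: "t \<in> {0..T}"
    have nonneg_t: "0 \<le> lam t i x" if "1 \<le> i" "x \<in> S" for i x
      using nonneg that t by simp
    show "(\<Sum>\<^sub>\<infinity>x\<in>S. second_moment (lam t) x) \<le> max 0 B"
      using B[OF t] global_moment_2(2)[of S lam t, OF nonneg_t fin[OF t]]
      by (auto simp: ennreal_le_iff2 max_def)
    have loc: "local_moment lam 2 x t < \<infinity>" if "x \<in> S" for x
      using le_less_trans[OF local_moment_le_global[OF that] fin[OF t]] .
    show "density S G C (lam t)"
    proof
      show "(\<lambda>x. \<Sum>\<^sub>\<infinity>i\<in>{1..}. (real i)\<^sup>2 * lam t i x) summable_on S"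
        using global_moment_2(1)[of S lam t, OF nonneg_t fin[OF t]]
        by (simp add: second_moment_def[abs_def])
      show "(\<lambda>i. (real i)\<^sup>2 * lam t i x) summable_on {1..}" if "x \<in> S" for x
        by (rule local_moment_2(1)) (use nonneg_t loc that in auto)
      show "0 \<le> G x y" if "x \<in> S" "y \<in> S" for x y
        using G that by (auto simp: spatial_kernel_def less_imp_le)
    qed (use C nonneg_t in auto)
  qed (rule T)
  then show ?thesis using fin that by blast
qed

section \<open>Transfer to extended-valued moments before \<open>T1\<close>\<close>

theorem proposition3p1:
  fixes S :: "'s set"
    and G :: "'s \<Rightarrow> 's \<Rightarrow> real"
    and lam :: "real \<Rightarrow> nat \<Rightarrow> 's \<Rightarrow> real"
    and T1 :: real
  assumes "countable S"
    and "spatial_kernel S G"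
    and "coagulation_solution S G lam"
    and "moment_control S G lam T1"
  shows "\<forall>t\<in>{0..<T1}.
      (\<forall>x\<in>S. local_moment lam 1 x t = ennreal (lam 0 1 x)) \<and>
      (\<forall>x\<in>S. ((\<lambda>s. enn2real (local_moment lam 2 x s)) has_real_derivative
         enn2real (local_moment lam 2 x t) *
           (\<Sum>\<^sub>\<infinity>y\<in>S. G x y * enn2real (local_moment lam 2 y t)))
         (at t within {0..<T1})) \<and>
      ((\<lambda>s. enn2real (global_moment S lam 2 s)) has_real_derivative
         (\<Sum>\<^sub>\<infinity>(x, y)\<in>S \<times> S. G x y * enn2real (local_moment lam 2 x t) *
            enn2real (local_moment lam 2 y t)))
         (at t within {0..<T1})"
proof
  fix t assume "t \<in> {0..<T1}"
  then have t: "0 \<le> t" "t < T1" by auto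
  \<comment> \<open>The midpoint keeps \<open>t\<close> strictly inside the closed interval
    \<open>{0..T}\<close>, which itself ends strictly before gelation.\<close>
  define T where "T = (t + T1) / 2"
  have T: "0 \<le> T" "t < T" "T < T1" using t by (auto simp: T_def)
  have "ereal T1 \<le> gelation_time S lam"
    using assms(4) by (simp add: moment_control_def)
  moreover have "ereal T < ereal T1" using T by simp
  ultimately have "ereal T < gelation_time S lam" by (rule less_le_trans[rotated])
  then obtain C B where flow: "coagulation_flow S G C lam T B"
    and fin: "\<And>s. s \<in> {0..T} \<Longrightarrow> global_moment S lam 2 s < \<infinity>"
    by (rule coagulation_solution_flow[OF assms(2,3) T(1)]) blast
  interpret coagulation_flow S G C lam T B by (rule flow)
  have tT: "t \<in> {0..T}" using t T by simp
  \<comment> \<open>As \<open>t < T < T1\<close>, both sets agree on the neighbourhood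
    \<open>{..<T}\<close> of \<open>t\<close>, and derivatives within them coincide.\<close>
  have within: "at t within {0..<T1} = at t within {0..T}"
    by (rule at_within_nhd[of _ "{..<T}"]) (use T in auto)
  have nonneg: "0 \<le> lam s i x" if "s \<in> {0..T}" "1 \<le> i" "x \<in> S" for s i x
    using density.mu_nonneg[OF density] that by blast
  have loc_fin: "local_moment lam 2 x s < \<infinity>" if "s \<in> {0..T}" "x \<in> S" for s x
    using le_less_trans[OF local_moment_le_global[OF that(2)] fin[OF that(1)]] .
  have loc1: "local_moment lam 1 x s = ennreal (\<Sum>\<^sub>\<infinity>i\<in>{1..}. real i * lam s i x)"
    if "s \<in> {0..T}" "x \<in> S" for s x
    by (rule local_moment_1) (use nonneg loc_fin that in auto)
  have loc2: "enn2real (local_moment lam 2 x s) = m2 x s" if "s \<in> {0..T}" "x \<in> S" for s x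
    using local_moment_2(2)[of lam s x] nonneg loc_fin m2_nonneg that by simp
  have glob2: "enn2real (global_moment S lam 2 s) = (\<Sum>\<^sub>\<infinity>x\<in>S. m2 x s)" if "s \<in> {0..T}" for s
    using global_moment_2(2)[of S lam s] nonneg fin m2_nonneg that by (simp add: infsum_nonneg)
  have "local_moment lam 1 x t = ennreal (lam 0 1 x)" if x: "x \<in> S" for x
  proof -
    \<comment> \<open>Conservation leads back to time 0, where the monodisperse initial condition
      gives the value.\<close>
    have "local_moment lam 1 x t = local_moment lam 1 x 0"
      using loc1[OF tT x] loc1[of 0 x] first_moment_conserved[OF x tT] T x by simp
    also have "\<dots> = ennreal (lam 0 1 x)"
      using assms(3) x unfolding coagulation_solution_def by blast
    finally show ?thesis .
  qed
  moreover have "((\<lambda>s. enn2real (local_moment lam 2 x s)) has_real_derivative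
         enn2real (local_moment lam 2 x t) *
           (\<Sum>\<^sub>\<infinity>y\<in>S. G x y * enn2real (local_moment lam 2 y t)))
         (at t within {0..<T1})" if x: "x \<in> S" for x
  proof -
    have eq: "(\<Sum>\<^sub>\<infinity>y\<in>S. G x y * enn2real (local_moment lam 2 y t)) = (\<Sum>\<^sub>\<infinity>y\<in>S. G x y * m2 y t)"
      by (rule infsum_cong) (simp only: loc2[OF tT])
    show ?thesis
      unfolding within eq loc2[OF tT x] growth_def[symmetric]
      \<comment> \<open>The two functions agree on all of \<open>{0..T}\<close>, so the radius 1 is
        an arbitrary choice.\<close>
      by (rule has_field_derivative_transform_within[OF m2_has_derivative[OF x tT] zero_less_one tT])
        (simp only: loc2[OF _ x])
  qed
  moreover have "((\<lambda>s. enn2real (global_moment S lam 2 s)) has_real_derivative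
         (\<Sum>\<^sub>\<infinity>(x, y)\<in>S \<times> S. G x y * enn2real (local_moment lam 2 x t) *
            enn2real (local_moment lam 2 y t)))
         (at t within {0..<T1})"
  proof -
    have eq: "(\<Sum>\<^sub>\<infinity>(x, y)\<in>S \<times> S. G x y * enn2real (local_moment lam 2 x t) *
            enn2real (local_moment lam 2 y t))
        = (\<Sum>\<^sub>\<infinity>(x, y)\<in>S \<times> S. G x y * m2 x t * m2 y t)"
      by (rule infsum_cong) (auto simp: loc2[OF tT])
    show ?thesis
      unfolding within eq
      by (rule has_field_derivative_transform_within[OF total_m2_has_derivative[OF tT] zero_less_one tT])
        (simp only: glob2)
  qed
  ultimately show "(\<forall>x\<in>S. local_moment lam 1 x t = ennreal (lam 0 1 x)) \<and>
      (\<forall>x\<in>S. ((\<lambda>s. enn2real (local_moment lam 2 x s)) has_real_derivative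
         enn2real (local_moment lam 2 x t) *
           (\<Sum>\<^sub>\<infinity>y\<in>S. G x y * enn2real (local_moment lam 2 y t)))
         (at t within {0..<T1})) \<and>
      ((\<lambda>s. enn2real (global_moment S lam 2 s)) has_real_derivative
         (\<Sum>\<^sub>\<infinity>(x, y)\<in>S \<times> S. G x y * enn2real (local_moment lam 2 x t) *
            enn2real (local_moment lam 2 y t)))
         (at t within {0..<T1})"
    by blast
qed

end
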